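(* Let $A$ be a unital Banach algebra in which every hermitian idempotent is ultrahermitian and any two hermitian idempotents commute. Then $A$ satisfies Rakočević's conjecture, that is: whenever $(a_n)_{n\in\mathbb{N}}$ is a sequence of Moore-Penrose invertible elements of $A$ that converges in norm to a Moore-Penrose invertible element $a\in A$, one has $a_n^\dagger\to a^\dagger$ if and only if $\sup_{n\in\mathbb{N}}\|a_n^\dagger\|<\infty$. In particular, Rakočević's conjecture holds for every unital $L^p$-operator algebra, for every $p\in[1,\infty)$.
   Context: Banach algebras are complex, and a unital Banach algebra has a contractive unit. An element $a$ of a unital Banach algebra $A$ is hermitian if $\|\exp(ita)\|=1$ for all $t\in\mathbb{R}$. An idempotent $e\in A$ is ultrahermitian if $\|eae+(1-e)b(1-e)\|\le 1$ for all $a,b\in A$ with $\|a\|,\|b\|\le1$. An element $a\in A$ is Moore-Penrose invertible if there is $b\in A$ with $a=aba$, $b=bab$, and $ab$, $ba$ hermitian; such $b$ is unique if it exists, is called the Moore-Penrose inverse of $a$, and is denoted $a^\dagger$. A Banach algebra is an $L^p$-operator algebra if it admits an isometric representation (isometric algebra homomorphism into $\mathcal{B}(E)$) on some $L^p$-space $E$. *)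

theory Defs
  imports "HOL-Analysis.Analysis"
begin

text \<open>
  The distribution has no classes for complex vector spaces, so they are layered on top of the real
  ones; \<open>scaleR_scaleC\<close> ties the two scalar multiplications together.
\<close>

class complex_vector = real_vector +
  fixes scaleC :: "complex \<Rightarrow> 'a \<Rightarrow> 'a" (infixr "*\<^sub>C" 75)
  assumes scaleC_add_right: "c *\<^sub>C (x + y) = c *\<^sub>C x + c *\<^sub>C y"
    and scaleC_add_left: "(c + d) *\<^sub>C x = c *\<^sub>C x + d *\<^sub>C x"
    and scaleC_scaleC: "c *\<^sub>C d *\<^sub>C x = (c * d) *\<^sub>C x"
    and scaleC_one: "1 *\<^sub>C x = x"
    and scaleR_scaleC: "r *\<^sub>R x = complex_of_real r *\<^sub>C x"

class complex_banach = complex_vector + banach +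
  assumes norm_scaleC: "norm (c *\<^sub>C x) = cmod c * norm x"

text \<open>
  \<open>real_normed_algebra_1\<close> requires \<open>norm 1 = 1\<close>.  This is the same as a contractive unit in a nonzero
  algebra; the zero algebra has no hermitian elements in the sense below (there
  \<open>norm (exp 0) = 0\<close>).
\<close>

class complex_banach_algebra_1 = complex_banach + real_normed_algebra_1 +
  assumes mult_scaleC_left: "(c *\<^sub>C x) * y = c *\<^sub>C (x * y)"
    and mult_scaleC_right: "x * (c *\<^sub>C y) = c *\<^sub>C (x * y)"

definition hermitian :: "'a::complex_banach_algebra_1 \<Rightarrow> bool" where
  "hermitian a \<longleftrightarrow> (\<forall>t::real. norm (exp ((\<i> * complex_of_real t) *\<^sub>C a)) = 1)"

definition idempotent :: "'a::complex_banach_algebra_1 \<Rightarrow> bool" where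
  "idempotent e \<longleftrightarrow> e * e = e"

definition ultrahermitian :: "'a::complex_banach_algebra_1 \<Rightarrow> bool" where
  "ultrahermitian e \<longleftrightarrow> idempotent e \<and>
     (\<forall>a b. norm a \<le> 1 \<longrightarrow> norm b \<le> 1 \<longrightarrow> norm (e * a * e + (1 - e) * b * (1 - e)) \<le> 1)"

definition is_MP_inverse :: "'a::complex_banach_algebra_1 \<Rightarrow> 'a \<Rightarrow> bool" where
  "is_MP_inverse a b \<longleftrightarrow>
     a = a * b * a \<and> b = b * a * b \<and> hermitian (a * b) \<and> hermitian (b * a)"

definition MP_invertible :: "'a::complex_banach_algebra_1 \<Rightarrow> bool" where
  "MP_invertible a \<longleftrightarrow> (\<exists>b. is_MP_inverse a b)"

definition MP_inverse :: "'a::complex_banach_algebra_1 \<Rightarrow> 'a" where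
  "MP_inverse a = (THE b. is_MP_inverse a b)"

definition rakocevic_conjecture :: "'a::complex_banach_algebra_1 itself \<Rightarrow> bool" where
  "rakocevic_conjecture _ \<longleftrightarrow>
     (\<forall>(X :: nat \<Rightarrow> 'a) (a :: 'a).
        (\<forall>n. MP_invertible (X n)) \<longrightarrow> MP_invertible a \<longrightarrow> X \<longlonglongrightarrow> a \<longrightarrow>
        ((\<lambda>n. MP_inverse (X n)) \<longlonglongrightarrow> MP_inverse a \<longleftrightarrow>
         bdd_above (range (\<lambda>n. norm (MP_inverse (X n))))))"

definition Lp_functions :: "real \<Rightarrow> 'b measure \<Rightarrow> ('b \<Rightarrow> complex) set" where
  "Lp_functions p M =
     {f \<in> borel_measurable M. integrable M (\<lambda>x. cmod (f x) powr p)}"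

definition Lp_seminorm :: "real \<Rightarrow> 'b measure \<Rightarrow> ('b \<Rightarrow> complex) \<Rightarrow> real" where
  "Lp_seminorm p M f = (\<integral>x. cmod (f x) powr p \<partial>M) powr (1 / p)"

text \<open>
  \<open>Lp_quotient_map p M q\<close> says that \<open>q\<close> exhibits the complex Banach space \<open>'e\<close> as \<open>L\<^sup>p(M)\<close>: since \<open>q\<close> is
  linear, onto and norm-preserving on the \<open>p\<close>-integrable functions, it identifies two of them exactly
  when they agree almost everywhere, and induces an isometric isomorphism from the quotient onto \<open>'e\<close>.
  The measure \<open>M\<close> is arbitrary, and values of \<open>q\<close> outside \<open>Lp_functions p M\<close> are irrelevant.
\<close>

definition Lp_quotient_map ::
  "real \<Rightarrow> 'b measure \<Rightarrow> (('b \<Rightarrow> complex) \<Rightarrow> 'e::complex_banach) \<Rightarrow> bool" where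
  "Lp_quotient_map p M q \<longleftrightarrow>
     (\<forall>f\<in>Lp_functions p M. \<forall>g\<in>Lp_functions p M. q (\<lambda>x. f x + g x) = q f + q g) \<and>
     (\<forall>c. \<forall>f\<in>Lp_functions p M. q (\<lambda>x. c * f x) = c *\<^sub>C q f) \<and>
     (\<forall>f\<in>Lp_functions p M. norm (q f) = Lp_seminorm p M f) \<and>
     q ` Lp_functions p M = UNIV"

text \<open>
  The type \<open>'e \<Rightarrow>\<^sub>L 'e\<close> consists of the bounded real-linear operators, with the operator norm; the third
  clause puts the range of \<open>\<phi>\<close> into the complex-linear ones.  Preservation of the unit is not required.
\<close>

definition isometric_representation ::
  "('a::complex_banach_algebra_1 \<Rightarrow> ('e::complex_banach \<Rightarrow>\<^sub>L 'e)) \<Rightarrow> bool" where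
  "isometric_representation \<phi> \<longleftrightarrow>
     (\<forall>a b. \<phi> (a + b) = \<phi> a + \<phi> b) \<and>
     (\<forall>c a v. blinfun_apply (\<phi> (c *\<^sub>C a)) v = c *\<^sub>C blinfun_apply (\<phi> a) v) \<and>
     (\<forall>a c v. blinfun_apply (\<phi> a) (c *\<^sub>C v) = c *\<^sub>C blinfun_apply (\<phi> a) v) \<and>
     (\<forall>a b. \<phi> (a * b) = \<phi> a o\<^sub>L \<phi> b) \<and>
     (\<forall>a. norm (\<phi> a) = norm a)"

text \<open>
  HOL cannot quantify over types inside a formula, so the type \<open>'b\<close> of points of the measure space and
  the type \<open>'e\<close> of elements of \<open>L\<^sup>p(M)\<close> are parameters.  In a premise, leaving them as free type
  variables amounts to asking for a representation on some \<open>L\<^sup>p\<close>-space.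
\<close>

definition Lp_operator_algebra ::
  "real \<Rightarrow> 'b itself \<Rightarrow> 'e::complex_banach itself \<Rightarrow> 'a::complex_banach_algebra_1 itself \<Rightarrow> bool" where
  "Lp_operator_algebra p _ _ _ \<longleftrightarrow>
     (\<exists>(M :: 'b measure) (q :: ('b \<Rightarrow> complex) \<Rightarrow> 'e) (\<phi> :: 'a \<Rightarrow> ('e \<Rightarrow>\<^sub>L 'e)).
        Lp_quotient_map p M q \<and> isometric_representation \<phi>)"

end

theory Submission
  imports Defs
begin

text \<open>
  Write \<open>e = a a'\<close>, \<open>f = b b'\<close> for Moore-Penrose inverses \<open>a'\<close>, \<open>b'\<close>. Both \<open>(1 - e) f\<close> and \<open>(1 - f) e\<close>
  are small when \<open>b\<close> is close to \<open>a\<close>, while \<open>b' - a'\<close> is controlled once \<open>f (1 - e)\<close> is small too,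
  and the same on the other side. So it suffices that \<open>norm (e (1 - f)) \<le> norm ((1 - f) e)\<close> for hermitian
  idempotents, which is trivial if they commute, and which holds on a Hilbert space since there they
  are orthogonal projections.

  For \<open>p \<noteq> 2\<close> hermitian idempotents acting on \<open>L\<^sup>p\<close> do commute. Let \<open>x\<close> and \<open>y\<close> be in the ranges of \<open>e\<close> and
  \<open>1 - e\<close>. The duality map \<open>u \<mapsto> \<bar>u\<bar>\<^sup>p\<^sup>-\<^sup>2 u\<close> is equivariant under the rotations \<open>e + w (1 - e)\<close>, so along
  \<open>x + w y\<close>, \<open>\<bar>w\<bar> = 1\<close>, it has the form \<open>A + w B\<close>. Pointwise this forces \<open>x = 0\<close> or \<open>y = 0\<close> unless
  \<open>\<bar>x\<bar> = \<bar>y\<bar>\<close>, and replacing \<open>y\<close> by \<open>2 y\<close> removes that exception. Hence the ranges of \<open>e\<close> and \<open>1 - e\<close>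
  are disjointly supported, and \<open>e f (1 - e) = 0\<close> follows by comparing supports.
\<close>

section \<open>Complex scalars and exponentials of idempotents\<close>

lemma scaleC_zero_right [simp]: "c *\<^sub>C (0::'a::complex_vector) = 0"
  using scaleC_add_right[of c 0 "0::'a"] by simp

lemma scaleC_zero_left [simp]: "0 *\<^sub>C (x::'a::complex_vector) = 0"
  using scaleC_add_left[of 0 0 x] by simp

lemma scaleC_minus_left: "(- c) *\<^sub>C (x::'a::complex_vector) = - (c *\<^sub>C x)"
  using scaleC_add_left[of c "- c" x] by (simp add: eq_neg_iff_add_eq_0 add.commute)

lemma bounded_linear_scaleC_left: "bounded_linear (\<lambda>c. c *\<^sub>C (x::'a::complex_banach))"
proof (rule bounded_linear_intro[where K = "norm x"])
  show "(r *\<^sub>R c) *\<^sub>C x = r *\<^sub>R (c *\<^sub>C x)" for r c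
    by (simp add: scaleR_scaleC scaleC_scaleC scaleR_conv_of_real)
qed (simp_all add: scaleC_add_left norm_scaleC)

text \<open>All positive powers of \<open>c *\<^sub>C e\<close> are multiples of \<open>e\<close>.
  Splitting the constant term as \<open>(1 - e) + e\<close> leaves the full series of
  \<open>exp c\<close> as the coefficient of \<open>e\<close>.\<close>

lemma exp_scaleC_idempotent:
  fixes e :: "'a::complex_banach_algebra_1"
  assumes "e * e = e"
  shows "exp (c *\<^sub>C e) = (1 - e) + exp c *\<^sub>C e"
proof -
  have pow: "(c *\<^sub>C e) ^ Suc n = c ^ Suc n *\<^sub>C e" for n
    using assms
    by (induction n) (simp_all add: mult_scaleC_left mult_scaleC_right scaleC_scaleC mult.commute)
  have term_eq: "(c *\<^sub>C e) ^ n /\<^sub>R fact n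
      = (if n = 0 then 1 - e else 0) + (c ^ n /\<^sub>R fact n) *\<^sub>C e" for n
  proof (cases n)
    case 0
    then show ?thesis by (simp add: scaleC_one)
  next
    case (Suc m)
    have "(c *\<^sub>C e) ^ n /\<^sub>R fact n = (c ^ n *\<^sub>C e) /\<^sub>R fact n"
      using pow Suc by metis
    then show ?thesis
      using Suc linear_scale[OF bounded_linear.linear[OF bounded_linear_scaleC_left],
          of "inverse (fact n)" "c ^ n" e] by simp
  qed
  have "(\<lambda>n. (if n = 0 then 1 - e else 0) + (c ^ n /\<^sub>R fact n) *\<^sub>C e) sums ((1 - e) + exp c *\<^sub>C e)"
    by (intro sums_add bounded_linear.sums[OF bounded_linear_scaleC_left] exp_converges sums_single)
  then show ?thesis
    using exp_converges[of "c *\<^sub>C e"] unfolding term_eq by (simp add: sums_iff)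
qed

lemma norm_mult_le:
  fixes x y :: "'a::real_normed_algebra"
  assumes "norm x \<le> c" "norm y \<le> d"
  shows "norm (x * y) \<le> c * d"
  using norm_mult_ineq mult_mono[OF assms] assms(1) norm_ge_zero order_trans by meson

section \<open>Hermitian idempotents as generators of rotations\<close>

definition hermitian_idempotent :: "'a::complex_banach_algebra_1 \<Rightarrow> bool" where
  "hermitian_idempotent e \<longleftrightarrow> idempotent e \<and> hermitian e"

text \<open>The exponential of \<open>i t e\<close> is \<open>(1 - e) + cis t e\<close>, and a
  unimodular factor turns it into a rotation that fixes the range of \<open>e\<close>. This is the
  form the geometric arguments use.\<close>

lemma hermitian_idempotent_iff:
  fixes e :: "'a::complex_banach_algebra_1"
  shows "hermitian_idempotent e \<longleftrightarrow>
    e * e = e \<and> (\<forall>w. cmod w = 1 \<longrightarrow> norm (e + w *\<^sub>C (1 - e)) = 1)"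
proof -
  have "hermitian e \<longleftrightarrow> (\<forall>w. cmod w = 1 \<longrightarrow> norm (e + w *\<^sub>C (1 - e)) = 1)" if e: "e * e = e"
  proof -
    have rot: "norm (e + w *\<^sub>C (1 - e)) = norm ((1 - e) + cnj w *\<^sub>C e)" if w: "cmod w = 1" for w
    proof -
      have "cnj w * w = 1"
        using w complex_norm_square[of w] by (simp add: mult.commute)
      then have "cnj w *\<^sub>C (e + w *\<^sub>C (1 - e)) = (1 - e) + cnj w *\<^sub>C e"
        by (simp add: scaleC_add_right scaleC_scaleC scaleC_one)
      then show ?thesis
        using norm_scaleC[of "cnj w" "e + w *\<^sub>C (1 - e)"] w by simp
    qed
    have "hermitian e \<longleftrightarrow> (\<forall>t::real. norm ((1 - e) + cis t *\<^sub>C e) = 1)"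
      unfolding hermitian_def by (simp add: exp_scaleC_idempotent[OF e] cis_conv_exp)
    also have "\<dots> \<longleftrightarrow> (\<forall>w. cmod w = 1 \<longrightarrow> norm ((1 - e) + w *\<^sub>C e) = 1)"
    proof (intro iffI allI impI)
      fix w assume *: "\<forall>t::real. norm ((1 - e) + cis t *\<^sub>C e) = 1" and "cmod w = 1"
      then obtain t where "w = cis t"
        using complex_norm_eq_1_exp[of w] by (metis cis_conv_exp)
      then show "norm ((1 - e) + w *\<^sub>C e) = 1" using * by simp
    qed simp
    also have "\<dots> \<longleftrightarrow> (\<forall>w. cmod w = 1 \<longrightarrow> norm (e + w *\<^sub>C (1 - e)) = 1)"
      using rot by (metis complex_cnj_cnj complex_mod_cnj)
    finally show ?thesis .
  qed
  then show ?thesis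
    unfolding hermitian_idempotent_def idempotent_def by blast
qed

lemma hermitian_idempotent_idem: "hermitian_idempotent e \<Longrightarrow> e * e = e"
  by (simp add: hermitian_idempotent_iff)

lemma hermitian_idempotent_rotation:
  "hermitian_idempotent e \<Longrightarrow> cmod w = 1 \<Longrightarrow> norm (e + w *\<^sub>C (1 - e)) = 1"
  by (simp add: hermitian_idempotent_iff)

text \<open>A unimodular factor exchanges the two summands that a rotation fixes and turns.\<close>

lemma hermitian_idempotent_compl:
  fixes e :: "'a::complex_banach_algebra_1"
  assumes "hermitian_idempotent e"
  shows "hermitian_idempotent (1 - e)"
  unfolding hermitian_idempotent_iff
proof (intro conjI allI impI)
  show "(1 - e) * (1 - e) = 1 - e"
    using hermitian_idempotent_idem[OF assms] by (simp add: algebra_simps)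
  fix w :: complex assume w: "cmod w = 1"
  have "w * cnj w = 1"
    using w complex_norm_square[of w] by simp
  then have "w *\<^sub>C (e + cnj w *\<^sub>C (1 - e)) = (1 - e) + w *\<^sub>C (1 - (1 - e))"
    by (simp add: scaleC_add_right scaleC_scaleC scaleC_one)
  then show "norm ((1 - e) + w *\<^sub>C (1 - (1 - e))) = 1"
    using norm_scaleC[of w "e + cnj w *\<^sub>C (1 - e)"] w
      hermitian_idempotent_rotation[OF assms, of "cnj w"] by simp
qed

text \<open>The rotation at \<open>w = - 1\<close> is the reflection \<open>2 e - 1\<close>, and
  \<open>e\<close> is the mean of it and \<open>1\<close>.\<close>

lemma norm_hermitian_idempotent_le:
  fixes e :: "'a::complex_banach_algebra_1"
  assumes "hermitian_idempotent e"
  shows "norm e \<le> 1"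
proof -
  have "e + (- 1) *\<^sub>C (1 - e) = 2 *\<^sub>R e - 1"
    by (simp add: scaleC_minus_left scaleC_one scaleR_2)
  then have "norm (2 *\<^sub>R e - 1) = 1"
    using hermitian_idempotent_rotation[OF assms, of "- 1"] by simp
  then have "norm (2 *\<^sub>R e) \<le> 2"
    using norm_triangle_ineq[of "2 *\<^sub>R e - 1" 1] by simp
  then show ?thesis by simp
qed

section \<open>Moore-Penrose inverses under perturbation\<close>

lemma hermitian_idempotent_MP:
  assumes "is_MP_inverse a b"
  shows "hermitian_idempotent (a * b)" "hermitian_idempotent (b * a)"
proof -
  have "a * b * (a * b) = (a * b * a) * b" "b * a * (b * a) = (b * a * b) * a"
    by (simp_all only: mult.assoc)
  then show "hermitian_idempotent (a * b)" "hermitian_idempotent (b * a)"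
    using assms unfolding is_MP_inverse_def hermitian_idempotent_def idempotent_def by auto
qed

text \<open>The hypothesis plays the role of the C*-identity \<open>norm (e * (1 - f)) = norm ((1 - f) * e)\<close>: it
  turns the factors \<open>b * b' * (1 - a * a')\<close> and \<open>(1 - b' * b) * (a' * a)\<close> below around, after which
  \<open>b - a\<close> can be split off.\<close>

lemma norm_MP_inverse_diff:
  fixes a b :: "'a::complex_banach_algebra_1"
  assumes swap: "\<And>e f::'a. hermitian_idempotent e \<Longrightarrow> hermitian_idempotent f \<Longrightarrow>
      norm (e * (1 - f)) \<le> norm ((1 - f) * e)"
    and a: "is_MP_inverse a a'" and b: "is_MP_inverse b b'"
  shows "norm (b' - a') \<le>
    norm (b - a) * (norm a' * norm b' + norm b' * norm b' + norm a' * norm a')"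
proof -
  note ha = hermitian_idempotent_MP[OF a] and hb = hermitian_idempotent_MP[OF b]
  have a1: "a * a' * a = a" "a' * a * a' = a'" and b1: "b * b' * b = b" "b' * b * b' = b'"
    using a b by (simp_all add: is_MP_inverse_def)
  have n1: "norm (1 - a * a') \<le> 1" "norm (1 - b' * b) \<le> 1"
    using norm_hermitian_idempotent_le[OF hermitian_idempotent_compl] ha hb by blast+
  have "b' - a' = b' * (a - b) * a' + b' * (b * b' * (1 - a * a')) - (1 - b' * b) * (a' * a) * a'"
  proof -
    have "b' * (b * b' * (1 - a * a')) = (b' * b * b') - (b' * b * b') * a * a'"
      "(1 - b' * b) * (a' * a) * a' = (a' * a * a') - b' * b * (a' * a * a')"
      by (simp_all only: algebra_simps mult_1_left mult_1_right)
    then show ?thesis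
      unfolding a1 b1 by (simp add: algebra_simps)
  qed
  also have "norm \<dots> \<le> norm (b' * (a - b) * a') + norm (b' * (b * b' * (1 - a * a')))
      + norm ((1 - b' * b) * (a' * a) * a')"
    by (rule order_trans[OF norm_triangle_ineq4 add_right_mono[OF norm_triangle_ineq]])
  also have "norm (b' * (a - b) * a') \<le> norm b' * norm (b - a) * norm a'"
    by (intro norm_mult_le) (simp_all add: norm_minus_commute)
  also have "norm (b' * (b * b' * (1 - a * a'))) \<le> norm b' * (norm (b - a) * norm b')"
  proof -
    \<comment> \<open>Since \<open>(1 - a * a') * a = 0\<close>, the factor \<open>b\<close> may be
      replaced by the small \<open>b - a\<close>.\<close>
    have "(1 - a * a') * (b * b') = (1 - a * a') * ((b - a) * b')"
    proof -
      have "(1 - a * a') * (a * b') = (a - a * a' * a) * b'" by (simp only: algebra_simps mult_1_left)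
      then have "(1 - a * a') * (a * b') = 0" by (simp add: a1)
      then show ?thesis by (simp add: algebra_simps)
    qed
    then have "norm ((1 - a * a') * (b * b')) \<le> norm (1 - a * a') * (norm (b - a) * norm b')"
      by (simp add: norm_mult_le norm_mult_ineq)
    also have "\<dots> \<le> norm (b - a) * norm b'"
      using n1(1) by (simp add: mult_left_le_one_le)
    finally have "norm (b * b' * (1 - a * a')) \<le> norm (b - a) * norm b'"
      using swap[OF hb(1) ha(1)] by simp
    then show ?thesis
      by (simp add: norm_mult_le)
  qed
  also have "norm ((1 - b' * b) * (a' * a) * a') \<le> norm a' * norm (b - a) * norm a'"
  proof -
    \<comment> \<open>The mirror image: \<open>b * (1 - b' * b) = 0\<close> lets \<open>a\<close> be
      replaced by \<open>a - b\<close>.\<close>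
    have "a' * a * (1 - b' * b) = (a' * (a - b)) * (1 - b' * b)"
    proof -
      have "a' * b * (1 - b' * b) = a' * (b - b * b' * b)" by (simp add: algebra_simps)
      then have "a' * b * (1 - b' * b) = 0" by (simp add: b1)
      moreover have "(a' * (a - b)) * z = a' * a * z - a' * b * z" for z
        by (simp only: right_diff_distrib left_diff_distrib)
      ultimately show ?thesis by simp
    qed
    then have "norm (a' * a * (1 - b' * b)) \<le> norm (a' * (a - b)) * norm (1 - b' * b)"
      using norm_mult_ineq by simp
    also have "\<dots> \<le> norm (a' * (a - b))"
      using n1(2) by (simp add: mult_left_le)
    also have "\<dots> \<le> norm a' * norm (b - a)"
      by (simp add: norm_mult_le norm_minus_commute)
    \<comment> \<open>The left-hand side of \<open>swap\<close> ends in a complement, so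
      \<open>a' * a\<close> enters as the complement of \<open>1 - a' * a\<close>.\<close>
    finally have "norm ((1 - b' * b) * (a' * a)) \<le> norm a' * norm (b - a)"
      using swap[OF hermitian_idempotent_compl[OF hb(2)] hermitian_idempotent_compl[OF ha(2)]] by simp
    then show ?thesis
      by (simp add: norm_mult_le)
  qed
  finally show ?thesis by (simp add: algebra_simps)
qed

text \<open>The perturbation bound serves twice: for equal elements it gives uniqueness of the
  Moore-Penrose inverse, and for bounded inverses it gives their convergence.\<close>

lemma rakocevic_if_swap:
  assumes swap: "\<And>e f::'a::complex_banach_algebra_1. hermitian_idempotent e \<Longrightarrow>
      hermitian_idempotent f \<Longrightarrow> norm (e * (1 - f)) \<le> norm ((1 - f) * e)"
  shows "rakocevic_conjecture TYPE('a)"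
  unfolding rakocevic_conjecture_def
proof (intro allI impI)
  fix X :: "nat \<Rightarrow> 'a" and a :: 'a
  assume X: "\<forall>n. MP_invertible (X n)" and a: "MP_invertible a" and lim: "X \<longlonglongrightarrow> a"
  have diff_le: "norm (c' - b') \<le> norm (c - b) * (norm b' * norm c' + norm c' * norm c' + norm b' * norm b')"
    if "is_MP_inverse b b'" "is_MP_inverse c c'" for b b' c c' :: 'a
    by (rule norm_MP_inverse_diff[OF swap that])
  have MP: "is_MP_inverse c (MP_inverse c)" if c: "MP_invertible c" for c :: 'a
  proof -
    obtain d where d: "is_MP_inverse c d"
      using c by (auto simp: MP_invertible_def)
    \<comment> \<open>The bound for two inverses of the same \<open>c\<close> has the factor
      \<open>norm (c - c)\<close>. This uniqueness is what makes the definite description in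
      \<open>MP_inverse\<close> meaningful.\<close>
    moreover have "d' = d" if "is_MP_inverse c d'" for d'
      using diff_le[OF d that] by simp
    ultimately show ?thesis
      unfolding MP_inverse_def by (metis theI)
  qed
  let ?Y = "\<lambda>n. MP_inverse (X n)" and ?b = "MP_inverse a"
  show "?Y \<longlonglongrightarrow> ?b \<longleftrightarrow> bdd_above (range (\<lambda>n. norm (?Y n)))"
  proof
    assume "?Y \<longlonglongrightarrow> ?b"
    then have "Bseq ?Y" using convergentI convergent_imp_Bseq by blast
    then show "bdd_above (range (\<lambda>n. norm (?Y n)))"
      unfolding Bseq_def bdd_above_def by auto
  next
    assume "bdd_above (range (\<lambda>n. norm (?Y n)))"
    then obtain K where K: "\<And>n. norm (?Y n) \<le> K"
      by (auto simp: bdd_above_def)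
    have "K \<ge> 0" using K[of 0] norm_ge_zero[of "?Y 0"] by linarith
    have "norm (?Y n - ?b) \<le> norm (X n - a) * (norm ?b * K + K * K + norm ?b * norm ?b)" for n
      using \<open>K \<ge> 0\<close> K[of n]
      by (intro order_trans[OF diff_le[OF MP[OF a] MP[OF X[rule_format, of n]]]]
          mult_left_mono add_mono mult_mono) auto
    moreover have "(\<lambda>n. norm (X n - a) * (norm ?b * K + K * K + norm ?b * norm ?b)) \<longlonglongrightarrow> 0"
      using lim by (auto intro!: tendsto_mult_left_zero tendsto_norm_zero simp: LIM_zero_iff)
    ultimately have "(\<lambda>n. ?Y n - ?b) \<longlonglongrightarrow> 0"
      by (rule Lim_null_comparison[OF always_eventually[OF allI]])
    then show "?Y \<longlonglongrightarrow> ?b" by (simp add: LIM_zero_iff)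
  qed
qed

corollary rakocevic_if_commute:
  assumes "\<And>e f::'a::complex_banach_algebra_1. hermitian_idempotent e \<Longrightarrow>
      hermitian_idempotent f \<Longrightarrow> e * f = f * e"
  shows "rakocevic_conjecture TYPE('a)"
  by (rule rakocevic_if_swap) (simp add: algebra_simps assms)

section \<open>A squeezed derivative and a cancellation for complex numbers\<close>

text \<open>The midpoint inequality turns the upper bound at \<open>- t\<close> into a lower bound
  at \<open>t\<close>, so the difference quotient of \<open>g\<close> at \<open>t\<close> lies
  between those of \<open>f\<close> at \<open>t\<close> and at \<open>- t\<close>. Here
  \<open>g\<close> will be a norm along a line and \<open>f\<close> a differentiable
  majorant.\<close>

lemma squeeze_real_derivative:
  fixes f g :: "real \<Rightarrow> real"
  assumes f: "(f has_real_derivative d) (at 0)"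
    and le: "\<And>t. g t \<le> f t" and eq: "g 0 = f 0"
    and mid: "\<And>t. 2 * g 0 \<le> g t + g (- t)"
  shows "(g has_real_derivative d) (at 0)"
proof -
  have lim: "((\<lambda>t. (f t - f 0) / t) \<longlongrightarrow> d) (at 0)"
    using f by (simp add: has_field_derivative_iff)
  then have lim': "((\<lambda>t. (f (- t) - f 0) / - t) \<longlongrightarrow> d) (at 0)"
    by (rule filterlim_compose) (simp add: filterlim_def filtermap_at_minus)
  \<comment> \<open>The sign of \<open>t\<close> decides which quotient of \<open>f\<close> is the
    upper one, hence \<open>max\<close> and \<open>min\<close>.\<close>
  have *: "(g t - f 0) / t - d \<le> max ((f t - f 0) / t - d) ((f (- t) - f 0) / - t - d)"
    "min ((f t - f 0) / t - d) ((f (- t) - f 0) / - t - d) \<le> (g t - f 0) / t - d" if "t \<noteq> 0" for t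
  proof -
    define A B C where "A = (f t - f 0) / t" and "B = (f (- t) - f 0) / - t" and "C = (g t - f 0) / t"
    have le': "g t - f 0 \<le> f t - f 0" "- (f (- t) - f 0) \<le> g t - f 0"
      using le[of t] le[of "- t"] mid[of t] eq by simp_all
    have B: "B = - (f (- t) - f 0) / t"
      unfolding B_def by (simp only: minus_divide_left minus_divide_right)
    have "C \<le> A \<and> B \<le> C \<or> A \<le> C \<and> C \<le> B"
    proof (cases "t > 0")
      case True
      then show ?thesis
        unfolding A_def B C_def using divide_right_mono[OF le'(1)] divide_right_mono[OF le'(2)]
        by (metis less_imp_le)
    next
      case False
      then show ?thesis
        unfolding A_def B C_def using divide_right_mono_neg[OF le'(1)] divide_right_mono_neg[OF le'(2)]
        by (metis not_le less_imp_le linear)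
    qed
    then show "(g t - f 0) / t - d \<le> max ((f t - f 0) / t - d) ((f (- t) - f 0) / - t - d)"
      "min ((f t - f 0) / t - d) ((f (- t) - f 0) / - t - d) \<le> (g t - f 0) / t - d"
      unfolding A_def[symmetric] B_def[symmetric] C_def[symmetric] by (auto simp: max_def min_def)
  qed
  have "((\<lambda>t. (g t - f 0) / t - d) \<longlongrightarrow> 0) (at 0)"
  proof (rule tendsto_sandwich)
    show "((\<lambda>t. min ((f t - f 0) / t - d) ((f (- t) - f 0) / - t - d)) \<longlongrightarrow> 0) (at 0)"
      "((\<lambda>t. max ((f t - f 0) / t - d) ((f (- t) - f 0) / - t - d)) \<longlongrightarrow> 0) (at 0)"
      using tendsto_max[OF lim[THEN LIM_zero] lim'[THEN LIM_zero]] 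
        tendsto_min[OF lim[THEN LIM_zero] lim'[THEN LIM_zero]] by simp_all
  next
    show "\<forall>\<^sub>F t in at 0. (g t - f 0) / t - d \<le> max ((f t - f 0) / t - d) ((f (- t) - f 0) / - t - d)"
      "\<forall>\<^sub>F t in at 0. min ((f t - f 0) / t - d) ((f (- t) - f 0) / - t - d) \<le> (g t - f 0) / t - d"
      using eventually_neq_at_within[of 0 0 UNIV] * by (auto elim!: eventually_mono)
  qed
  then show ?thesis
    using eq by (simp add: has_field_derivative_iff LIM_zero_iff)
qed

text \<open>Pointwise core of the case \<open>p \<noteq> 2\<close>, with \<open>r = p - 2\<close>.
  The hypotheses amount to \<open>S x = - z y\<close> and \<open>S y = - cnj z x\<close> for a
  complex \<open>z\<close> and a real \<open>S\<close>; so \<bar>S\<bar> is the modulus of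
  \<open>z\<close>, and unequal moduli of \<open>x\<close> and \<open>y\<close> leave only
  \<open>S = 0\<close>, where all four weights agree.\<close>

lemma differenced_duality_cancel:
  fixes x y :: complex and r :: real
  defines "c w \<equiv> cmod (x + w * y) powr r"
  assumes "r \<noteq> 0" and ne: "cmod x \<noteq> cmod y"
    and 1: "c 1 * (x + y) + c (- 1) * (x - y) = c \<i> * (x + \<i> * y) + c (- \<i>) * (x - \<i> * y)"
    and 2: "c 1 * (y + x) + c (- 1) * (y - x) = c (- \<i>) * (y + \<i> * x) + c \<i> * (y - \<i> * x)"
  shows "x = 0 \<or> y = 0"
proof (rule disjCI)
  assume "y \<noteq> 0"
  define S where "S = c 1 + c (- 1) - c \<i> - c (- \<i>)"
  define D where "D = c 1 - c (- 1)"
  define D' where "D' = c \<i> - c (- \<i>)"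
  have e1: "of_real S * x = - Complex D (- D') * y"
    using 1 unfolding S_def D_def D'_def complex_eq_iff by (simp add: algebra_simps)
  have e2: "of_real S * y = - Complex D D' * x"
    using 2 unfolding S_def D_def D'_def complex_eq_iff by (simp add: algebra_simps)
  show "x = 0"
  proof (rule ccontr)
    assume "x \<noteq> 0"
    have "of_real S * of_real S * x = - Complex D (- D') * (of_real S * y)"
      using e1 by (simp add: mult.assoc) 
    also have "\<dots> = of_real (D\<^sup>2 + D'\<^sup>2) * x"
      unfolding e2 complex_eq_iff by (simp add: power2_eq_square algebra_simps)
    finally have SD: "S\<^sup>2 = D\<^sup>2 + D'\<^sup>2"
      using \<open>x \<noteq> 0\<close> by (simp add: power2_eq_square flip: of_real_mult of_real_add)
    have "\<bar>S\<bar> * cmod x = cmod (Complex D (- D')) * cmod y"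
      using arg_cong[OF e1, of cmod] by (simp add: norm_mult)
    also have "cmod (Complex D (- D')) = \<bar>S\<bar>"
      by (simp add: cmod_def flip: SD)
    finally have "S = 0" using ne by simp
    then have "D = 0" "D' = 0" using SD by (simp_all add: sum_power2_eq_zero_iff)
    with \<open>S = 0\<close> have ceq: "c 1 = c (- 1)" "c \<i> = c 1" "c (- \<i>) = c 1"
      unfolding S_def D_def D'_def by auto
    have nz: "x + w * y \<noteq> 0" if "cmod w = 1" for w
      proof
      assume "x + w * y = 0"
      then have "cmod x = cmod (w * y)" by (simp add: eq_neg_iff_add_eq_0[symmetric])
      then show False using ne that by (simp add: norm_mult)
    qed
    have root: "cmod (x + w * y) = c w powr (1 / r)" if "cmod w = 1" for w
      using nz[OF that] \<open>r \<noteq> 0\<close> by (simp add: c_def powr_powr)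
    \<comment> \<open>Equal moduli for opposite signs of \<open>y\<close> kill the real part of
      \<open>x * cnj y\<close>, and those for opposite signs of \<open>\<i> * y\<close> its
      imaginary part.\<close>
    have "cmod (x + y) = cmod (x - y)" "cmod (x + \<i> * y) = cmod (x - \<i> * y)"
      using root[of 1] root[of "- 1"] root[of \<i>] root[of "- \<i>"] ceq by simp_all
    then have "Re x * Re y + Im x * Im y = 0" "Im x * Re y - Re x * Im y = 0"
      unfolding cmod_def by (simp_all add: power2_eq_square algebra_simps)
    then have "x * cnj y = 0"
      by (simp add: complex_eq_iff)
    then show False using \<open>x \<noteq> 0\<close> \<open>y \<noteq> 0\<close> by simp
  qed
qed

section \<open>Differentiating integrals of \<open>p\<close>-th powers\<close>

text \<open>Away from \<open>0\<close> the modulus is the root of a positive polynomial in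
  \<open>t\<close>; at \<open>u = 0\<close> the hypothesis makes the path constant.\<close>

lemma DERIV_cmod_powr:
  fixes u h :: complex
  assumes "u \<noteq> 0 \<or> h = 0"
  shows "((\<lambda>t. cmod (u + of_real t * h) powr p) has_real_derivative
    p * cmod u powr (p - 2) * Re (h * cnj u)) (at 0)"
proof (cases "u = 0")
  case True
  then show ?thesis using assms by simp
next
  case False
  have sq: "cmod z powr q = ((Re z)\<^sup>2 + (Im z)\<^sup>2) powr (q / 2)" for z q
    by (simp add: cmod_def powr_half_sqrt[symmetric] powr_powr)
  have pos: "(Re u)\<^sup>2 + (Im u)\<^sup>2 > 0"
    using False by (metis complex_neq_0)
  have "((\<lambda>t. ((Re u + t * Re h)\<^sup>2 + (Im u + t * Im h)\<^sup>2) powr (p / 2)) has_real_derivative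
    p * cmod u powr (p - 2) * Re (h * cnj u)) (at 0)"
  proof -
    have "((\<lambda>t. (Re u + t * Re h)\<^sup>2 + (Im u + t * Im h)\<^sup>2) has_real_derivative
      2 * Re (h * cnj u)) (at 0)"
      by (auto intro!: derivative_eq_intros simp: algebra_simps)
    then have "((\<lambda>t. ((Re u + t * Re h)\<^sup>2 + (Im u + t * Im h)\<^sup>2) powr (p / 2)) has_real_derivative
        p / 2 * ((Re u + 0 * Re h)\<^sup>2 + (Im u + 0 * Im h)\<^sup>2) powr (p / 2 - of_nat 1)
          * (2 * Re (h * cnj u))) (at 0)"
      by (rule DERIV_fun_powr) (use pos in simp)
    then show ?thesis
      by (rule DERIV_cong) (simp add: sq diff_divide_distrib algebra_simps)
  qed
  then show ?thesis unfolding sq by simp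
qed

text \<open>Mean value theorem; for \<open>p \<ge> 1\<close> the derivative is largest at the right
  end. It supplies the majorant of the difference quotients.\<close>

lemma powr_diff_le:
  fixes r s b p :: real
  assumes "1 \<le> p" "0 \<le> r" "r \<le> b" "0 \<le> s" "s \<le> b"
  shows "\<bar>r powr p - s powr p\<bar> \<le> p * b powr (p - 1) * \<bar>r - s\<bar>"
proof -
  have *: "\<bar>r powr p - s powr p\<bar> \<le> p * b powr (p - 1) * \<bar>r - s\<bar>"
    if "0 \<le> s" "s < r" "r \<le> b" for r s
  proof -
    have der: "((\<lambda>x. x powr p) has_real_derivative p * x powr (p - 1)) (at x)" if "s < x" for x
      using has_real_derivative_powr[of x p] that \<open>0 \<le> s\<close> by simp
    have "continuous_on {s..r} (\<lambda>x. x powr p)"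
      using \<open>0 \<le> s\<close> \<open>1 \<le> p\<close> by (intro continuous_on_powr' continuous_intros) auto
    then obtain l z where z: "s < z" "z < r" and l: "((\<lambda>x. x powr p) has_real_derivative l) (at z)"
      and eq: "r powr p - s powr p = (r - s) * l"
      using MVT[OF \<open>s < r\<close>, of "\<lambda>x. x powr p"] der real_differentiable_def by metis
    have l: "l = p * z powr (p - 1)" using DERIV_unique[OF l der[OF z(1)]] .
    have "z powr (p - 1) \<le> b powr (p - 1)"
      using z that assms by (intro powr_mono2) auto
    then have "\<bar>l\<bar> \<le> p * b powr (p - 1)"
      using \<open>1 \<le> p\<close> unfolding l by (simp add: abs_mult)
    then show ?thesis
      using mult_right_mono[of "\<bar>l\<bar>" "p * b powr (p - 1)" "\<bar>r - s\<bar>"]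
      unfolding eq by (simp add: abs_mult mult.commute)
  qed
  show ?thesis
    using *[of s r] *[of r s] assms
    by (cases r s rule: linorder_cases) (simp_all add: abs_minus_commute)
qed

lemma borel_measurable_cnj [measurable]:
  "f \<in> borel_measurable M \<Longrightarrow> (\<lambda>x. cnj (f x)) \<in> borel_measurable M"
  by (rule borel_measurable_continuous_on[OF continuous_on_cnj[OF continuous_on_id]])

text \<open>A sum is at most twice the larger summand, which bounds its \<open>p\<close>-th power by
  an integrable function. Sums, multiples and the later majorant are all instances.\<close>

lemma Lp_functions_dominated:
  assumes f: "f \<in> Lp_functions p M" and g: "g \<in> Lp_functions p M" and "1 \<le> p"
    and k: "k \<in> borel_measurable M" and le: "\<And>x. cmod (k x) \<le> cmod (f x) + C * cmod (g x)" and "0 \<le> C"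
  shows "k \<in> Lp_functions p M" "integrable M (\<lambda>x. (cmod (f x) + C * cmod (g x)) powr p)"
proof -
  have [measurable]: "f \<in> borel_measurable M" "g \<in> borel_measurable M" "k \<in> borel_measurable M"
    and int: "integrable M (\<lambda>x. cmod (f x) powr p)" "integrable M (\<lambda>x. cmod (g x) powr p)"
    using f g k by (auto simp: Lp_functions_def)
  have bnd: "(r + C * s) powr p \<le> 2 powr p * r powr p + (2 * C) powr p * s powr p"
    if "0 \<le> r" "0 \<le> s" for r s
  proof -
    have "(r + C * s) powr p \<le> (2 * max r (C * s)) powr p"
      using that assms by (intro powr_mono2) auto
    also have "\<dots> \<le> (2 * r) powr p + (2 * C * s) powr p"
      using that assms by (auto simp: max_def mult.assoc)
    finally show ?thesis
      using that assms by (simp add: powr_mult)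
  qed
  show *: "integrable M (\<lambda>x. (cmod (f x) + C * cmod (g x)) powr p)"
    by (rule Bochner_Integration.integrable_bound[OF
          Bochner_Integration.integrable_add[OF integrable_mult_right[OF int(1), of "2 powr p"]
            integrable_mult_right[OF int(2), of "(2 * C) powr p"]]])
      (use bnd in \<open>auto intro!: AE_I2\<close>)
  have "integrable M (\<lambda>x. cmod (k x) powr p)"
    by (rule Bochner_Integration.integrable_bound[OF *])
      (use le assms in \<open>auto intro!: AE_I2 powr_mono2\<close>)
  then show "k \<in> Lp_functions p M" by (simp add: Lp_functions_def)
qed

lemma Lp_functions_add:
  assumes "f \<in> Lp_functions p M" "g \<in> Lp_functions p M" "1 \<le> p"
  shows "(\<lambda>x. f x + g x) \<in> Lp_functions p M"
proof (rule Lp_functions_dominated(1)[OF assms, of _ 1])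
  show "(\<lambda>x. f x + g x) \<in> borel_measurable M"
    using assms by (auto simp: Lp_functions_def)
qed (simp_all add: norm_triangle_ineq)

lemma Lp_functions_cmult:
  assumes "f \<in> Lp_functions p M" "1 \<le> p"
  shows "(\<lambda>x. c * f x) \<in> Lp_functions p M"
proof (rule Lp_functions_dominated(1)[OF assms(1,1,2), of _ "cmod c"])
  show "(\<lambda>x. c * f x) \<in> borel_measurable M"
    using assms by (auto simp: Lp_functions_def)
qed (simp_all add: norm_mult)

text \<open>Dominated convergence for the difference quotients along every null sequence of nonzero
  reals.\<close>

lemma DERIV_integral_powr:
  assumes u: "u \<in> Lp_functions p M" and h: "h \<in> Lp_functions p M" and p: "1 \<le> p"
    and supp: "\<And>x. u x \<noteq> 0 \<or> h x = 0"
  shows "integrable M (\<lambda>x. p * cmod (u x) powr (p - 2) * Re (h x * cnj (u x)))" (is ?int)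
    and "((\<lambda>t. \<integral>x. cmod (u x + of_real t * h x) powr p \<partial>M) has_real_derivative
      (\<integral>x. p * cmod (u x) powr (p - 2) * Re (h x * cnj (u x)) \<partial>M)) (at 0)" (is ?der)
proof -
  have [measurable]: "u \<in> borel_measurable M" "h \<in> borel_measurable M"
    using u h by (auto simp: Lp_functions_def)
  let ?D = "\<lambda>x. p * cmod (u x) powr (p - 2) * Re (h x * cnj (u x))"
  let ?F = "\<lambda>t x. cmod (u x + of_real t * h x) powr p"
  let ?I = "\<lambda>t. \<integral>x. ?F t x \<partial>M"
  have F_int: "integrable M (?F t)" for t
    using Lp_functions_add[OF u Lp_functions_cmult[OF h p, of "of_real t"] p]
    by (simp add: Lp_functions_def)
  have main: "integrable M ?D \<and> (\<lambda>i. (?I (X i) - ?I 0) / X i) \<longlonglongrightarrow> (\<integral>x. ?D x \<partial>M)"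
    if X: "\<And>i. X i \<noteq> 0" "X \<longlonglongrightarrow> 0" for X :: "nat \<Rightarrow> real"
  proof -
    obtain K where K: "K > 0" "\<And>i. \<bar>X i\<bar> \<le> K"
      using convergent_imp_Bseq[OF convergentI[OF X(2)]] by (auto simp: Bseq_def)
    \<comment> \<open>The summand \<open>1\<close> ensures \<open>1 \<le> C\<close>, so that
      \<open>cmod (u x) + C * cmod (h x)\<close> bounds \<open>cmod (h x)\<close> as well as the
      moduli along the path.\<close>
    define C where "C = K + 1"
    define w where "w x = p * (cmod (u x) + C * cmod (h x)) powr p" for x
    define s where "s i x = (?F (X i) x - ?F 0 x) / X i" for i x
    have w: "integrable M w"
      unfolding w_def using K(1) Lp_functions_dominated(2)[OF u h p, of u C]
      by (intro integrable_mult_right) (auto simp: C_def)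
    have lim: "(\<lambda>i. s i x) \<longlonglongrightarrow> ?D x" for x
    proof -
      have "((\<lambda>t. (?F t x - ?F 0 x) / t) \<longlongrightarrow> ?D x) (at 0)"
        using DERIV_cmod_powr[OF supp[of x], of p] by (simp add: has_field_derivative_iff)
      then show ?thesis
        using X unfolding tendsto_at_iff_sequentially s_def by (auto simp: comp_def)
    qed
    have bound: "norm (s i x) \<le> w x" for i x
    proof -
      define b where "b = cmod (u x) + C * cmod (h x)"
      have "\<bar>X i\<bar> \<le> C" and "1 \<le> C" using K(1) K(2)[of i] by (simp_all add: C_def)
      then have Xh: "\<bar>X i\<bar> * cmod (h x) \<le> C * cmod (h x)" and "1 * cmod (h x) \<le> C * cmod (h x)"
        by (simp_all only: mult_right_mono norm_ge_zero)
      then have hb: "cmod (h x) \<le> b"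
        using norm_ge_zero[of "u x"] unfolding b_def by linarith
      have "cmod (u x + of_real (X i) * h x) \<le> b"
        using norm_triangle_ineq[of "u x" "of_real (X i) * h x"] Xh
        by (simp add: b_def norm_mult)
      moreover have "cmod (u x) \<le> b" using K(1) by (simp add: b_def C_def)
      ultimately have "\<bar>?F (X i) x - ?F 0 x\<bar> \<le> p * b powr (p - 1) *
          \<bar>cmod (u x + of_real (X i) * h x) - cmod (u x)\<bar>"
        using powr_diff_le[OF p, of "cmod (u x + of_real (X i) * h x)" b "cmod (u x)"] by simp
      also have "\<dots> \<le> p * b powr (p - 1) * (\<bar>X i\<bar> * b)"
      proof (intro mult_left_mono)
        have "\<bar>cmod (u x + of_real (X i) * h x) - cmod (u x)\<bar> \<le> \<bar>X i\<bar> * cmod (h x)"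
          using norm_triangle_ineq3[of "u x + of_real (X i) * h x" "u x"] by (simp add: norm_mult)
        also have "\<dots> \<le> \<bar>X i\<bar> * b" using hb by (intro mult_left_mono) auto
        finally show "\<bar>cmod (u x + of_real (X i) * h x) - cmod (u x)\<bar> \<le> \<bar>X i\<bar> * b" .
      qed (use p in auto)
      also have "\<dots> = w x * \<bar>X i\<bar>"
      proof -
        have "b powr (p - 1) * b = b powr p"
          using powr_mult_base[of b "p - 1"] hb norm_ge_zero[of "h x"] by (simp add: mult.commute)
        then show ?thesis by (simp add: w_def flip: b_def)
      qed
      finally show ?thesis
        using X(1)[of i] by (simp add: s_def divide_le_eq)
    qed
    have meas: "?D \<in> borel_measurable M" by measurable
    have meas': "s i \<in> borel_measurable M" for i
      unfolding s_def by measurable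
    have "(\<lambda>i. \<integral>x. s i x \<partial>M) \<longlonglongrightarrow> (\<integral>x. ?D x \<partial>M)"
      by (rule integral_dominated_convergence[where s = s, OF meas meas' w]) (use lim bound in auto)
    moreover have "(\<integral>x. s i x \<partial>M) = (?I (X i) - ?I 0) / X i" for i
      unfolding s_def using F_int[of "X i"] F_int[of 0] by simp
    moreover have "integrable M ?D"
      by (rule integrable_dominated_convergence[where s = s, OF meas meas' w]) (use lim bound in auto)
    ultimately show ?thesis by simp
  qed
  show ?int
    using main[of "\<lambda>i. 1 / real (Suc i)"] LIMSEQ_inverse_real_of_nat by (simp add: inverse_eq_divide)
  show ?der
    unfolding has_field_derivative_iff tendsto_at_iff_sequentially
    using main by (auto simp: comp_def)
qed

section \<open>The Banach space \<open>L\<^sup>p(M)\<close> realised by \<open>q\<close>\<close>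

locale Lp_space =
  fixes p :: real and M :: "'b measure" and q :: "('b \<Rightarrow> complex) \<Rightarrow> 'e::complex_banach"
  assumes p: "1 \<le> p" and quotient: "Lp_quotient_map p M q"
begin

lemma q_add: "f \<in> Lp_functions p M \<Longrightarrow> g \<in> Lp_functions p M \<Longrightarrow> q (\<lambda>x. f x + g x) = q f + q g"
  and q_cmult: "f \<in> Lp_functions p M \<Longrightarrow> q (\<lambda>x. c * f x) = c *\<^sub>C q f"
  and norm_q: "f \<in> Lp_functions p M \<Longrightarrow> norm (q f) = Lp_seminorm p M f"
  using quotient by (auto simp: Lp_quotient_map_def)

lemma q_surj: obtains f where "f \<in> Lp_functions p M" "q f = v"
  using quotient unfolding Lp_quotient_map_def by (metis UNIV_I imageE)

lemma q_lincomb: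
  assumes "f \<in> Lp_functions p M" "g \<in> Lp_functions p M"
  shows "(\<lambda>x. f x + c * g x) \<in> Lp_functions p M" "q (\<lambda>x. f x + c * g x) = q f + c *\<^sub>C q g"
  using assms Lp_functions_cmult[OF assms(2) p, of c]
  by (simp_all add: Lp_functions_add p q_add q_cmult)

lemma norm_q_powr:
  assumes "f \<in> Lp_functions p M"
  shows "norm (q f) powr p = (\<integral>x. cmod (f x) powr p \<partial>M)"
  using assms p by (simp add: norm_q Lp_seminorm_def powr_powr)

lemma q_eq_0_iff:
  assumes f: "f \<in> Lp_functions p M"
  shows "q f = 0 \<longleftrightarrow> (AE x in M. f x = 0)"
proof -
  have "q f = 0 \<longleftrightarrow> (\<integral>x. cmod (f x) powr p \<partial>M) = 0"
    using norm_q_powr[OF f] by (metis norm_eq_zero powr_eq_0_iff)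
  also have "\<dots> \<longleftrightarrow> (AE x in M. cmod (f x) powr p = 0)"
    using f by (intro integral_nonneg_eq_0_iff_AE) (auto simp: Lp_functions_def)
  finally show ?thesis by simp
qed

lemma q_eq_iff:
  assumes f: "f \<in> Lp_functions p M" and g: "g \<in> Lp_functions p M"
  shows "q f = q g \<longleftrightarrow> (AE x in M. f x = g x)"
proof -
  have "q f = q g \<longleftrightarrow> q (\<lambda>x. f x + (- 1) * g x) = 0"
    unfolding q_lincomb(2)[OF f g] by (simp add: scaleC_minus_left scaleC_one)
  also have "\<dots> \<longleftrightarrow> (AE x in M. f x = g x)"
    unfolding q_eq_0_iff[OF q_lincomb(1)[OF f g]] by simp
  finally show ?thesis .
qed

text \<open>On the real line \<open>t \<mapsto> u + t h\<close> the norm is differentiable at \<open>0\<close> as soon as \<open>h\<close> lives on the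
  support of \<open>u\<close>, also for \<open>p = 1\<close>.\<close>

lemma DERIV_norm_q:
  assumes u: "u \<in> Lp_functions p M" and h: "h \<in> Lp_functions p M"
    and supp: "\<And>x. u x \<noteq> 0 \<or> h x = 0" and nz: "q u \<noteq> 0"
  shows "((\<lambda>t. norm (q u + t *\<^sub>R q h)) has_real_derivative
    norm (q u) powr (1 - p) * (\<integral>x. cmod (u x) powr (p - 2) * Re (h x * cnj (u x)) \<partial>M)) (at 0)"
proof -
  let ?I = "\<lambda>t. \<integral>x. cmod (u x + of_real t * h x) powr p \<partial>M"
  let ?J = "\<integral>x. cmod (u x) powr (p - 2) * Re (h x * cnj (u x)) \<partial>M"
  have norm_eq: "norm (q u + t *\<^sub>R q h) = ?I t powr (1 / p)" for t
    using norm_q[OF q_lincomb(1)[OF u h, of "of_real t"]] q_lincomb(2)[OF u h, of "of_real t"]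
    by (simp add: scaleR_scaleC Lp_seminorm_def)
  have I0: "?I 0 = norm (q u) powr p"
    using norm_q_powr[OF u] by simp
  have "(?I has_real_derivative p * ?J) (at 0)"
    using DERIV_integral_powr(2)[OF u h p supp] by (simp add: mult.assoc)
  then have "((\<lambda>t. ?I t powr (1 / p)) has_real_derivative
      1 / p * ?I 0 powr (1 / p - of_nat 1) * (p * ?J)) (at 0)"
    by (rule DERIV_fun_powr) (use nz I0 in simp)
  then show ?thesis
    unfolding norm_eq
  proof (rule DERIV_cong)
    have "p * (1 / p - of_nat 1) = 1 - p" using p by (simp add: right_diff_distrib)
    then show "1 / p * ?I 0 powr (1 / p - of_nat 1) * (p * ?J) = norm (q u) powr (1 - p) * ?J"
      unfolding I0 powr_powr using p by simp
  qed
qed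

end

section \<open>Isometric representations and the action of rotations\<close>

locale isometric_rep =
  fixes \<phi> :: "'a::complex_banach_algebra_1 \<Rightarrow> ('e::complex_banach \<Rightarrow>\<^sub>L 'e)"
  assumes rep: "isometric_representation \<phi>"
begin

abbreviation act :: "'a \<Rightarrow> 'e \<Rightarrow> 'e"  (infixr "\<cdot>" 75)
  where "a \<cdot> v \<equiv> blinfun_apply (\<phi> a) v"

lemma act_add: "(a + b) \<cdot> v = a \<cdot> v + b \<cdot> v"
  and act_scaleC: "(c *\<^sub>C a) \<cdot> v = c *\<^sub>C (a \<cdot> v)"
  and act_scaleC_right: "a \<cdot> (c *\<^sub>C v) = c *\<^sub>C (a \<cdot> v)"
  and act_mult: "(a * b) \<cdot> v = a \<cdot> b \<cdot> v"
  and norm_rep: "norm (\<phi> a) = norm a"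
  using rep by (simp_all add: isometric_representation_def plus_blinfun.rep_eq)

lemma act_zero: "0 \<cdot> v = 0"
  using act_add[of 0 0 v] by simp

lemma act_diff: "(a - b) \<cdot> v = a \<cdot> v - b \<cdot> v"
  using act_add[of "a - b" b v] by (simp add: eq_diff_eq)

lemma norm_act_le: "norm (a \<cdot> v) \<le> norm a * norm v"
  using norm_blinfun[of "\<phi> a" v] by (simp add: norm_rep)

lemma act_eq_0: "(\<And>v. a \<cdot> v = 0) \<Longrightarrow> a = 0"
  using norm_rep[of a] by (metis blinfun_eqI norm_eq_zero zero_blinfun.rep_eq)

text \<open>As \<open>1\<close> need not act as the identity, \<open>e \<cdot> y = 0\<close> and
  \<open>(1 - e) \<cdot> x = 0\<close> are taken from \<open>e * (1 - e) = 0\<close> and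
  \<open>(1 - e) * e = 0\<close>.\<close>

lemma rotation_act:
  assumes e: "hermitian_idempotent e" and w: "cmod w = 1"
    and x: "e \<cdot> x = x" and y: "(1 - e) \<cdot> y = y"
  shows "(e + cnj w *\<^sub>C (1 - e)) \<cdot> (x + w *\<^sub>C y) = x + y"
proof -
  have "e * (1 - e) = 0" "(1 - e) * e = 0"
    using hermitian_idempotent_idem[OF e] by (simp_all add: algebra_simps)
  then have "e \<cdot> y = 0" "(1 - e) \<cdot> x = 0"
    by (metis act_mult act_zero x y)+
  moreover have "w * cnj w = 1" "cnj w * w = 1"
    using w complex_norm_square[of w] by (simp_all add: mult.commute)
  ultimately show ?thesis
    by (simp add: act_add act_scaleC act_scaleC_right blinfun.add_right scaleC_scaleC scaleC_one x y)
qed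

text \<open>Rotations are contractive, which gives one inequality; the same argument for
  \<open>cnj w\<close> and \<open>w *\<^sub>C y\<close> gives the other.\<close>

lemma norm_rotation:
  assumes e: "hermitian_idempotent e" and w: "cmod w = 1"
    and x: "e \<cdot> x = x" and y: "(1 - e) \<cdot> y = y"
  shows "norm (x + w *\<^sub>C y) = norm (x + y)"
proof (rule antisym)
  have "norm (x + v *\<^sub>C z) \<ge> norm (x + z)" if "cmod v = 1" "(1 - e) \<cdot> z = z" for v z
    using norm_act_le[of "e + cnj v *\<^sub>C (1 - e)" "x + v *\<^sub>C z"] rotation_act[OF e that(1) x that(2)]
      hermitian_idempotent_rotation[OF e, of "cnj v"] that(1) by simp
  from this[OF w y] this[of "cnj w" "w *\<^sub>C y"]
  show "norm (x + y) \<le> norm (x + w *\<^sub>C y)" "norm (x + w *\<^sub>C y) \<le> norm (x + y)"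
    using w complex_norm_square[of w]
    by (simp_all add: scaleC_scaleC act_scaleC_right y scaleC_one mult.commute)
qed

text \<open>The rotations \<open>e + cnj w (1 - e)\<close> move all the points \<open>x + w y\<close> to \<open>x + y\<close>. The directions
  \<open>h\<close> at \<open>x + w y\<close> and at \<open>x - w y\<close> are moved to two directions with mean \<open>e h\<close>, whatever \<open>w\<close> is;
  as the representation need not be unital, the rotations are only contractions of the whole space,
  and convexity of the norm takes over.\<close>

lemma DERIV_norm_mean:
  assumes e: "hermitian_idempotent e" and w: "cmod w = 1"
    and x: "e \<cdot> x = x" and y: "(1 - e) \<cdot> y = y"
    and d: "((\<lambda>t. norm (x + w *\<^sub>C y + t *\<^sub>R h)) has_real_derivative d) (at 0)"
    and d': "((\<lambda>t. norm (x + (- w) *\<^sub>C y + t *\<^sub>R h)) has_real_derivative d') (at 0)"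
  shows "((\<lambda>t. norm (x + y + t *\<^sub>R (e \<cdot> h))) has_real_derivative (d + d') / 2) (at 0)"
proof (rule squeeze_real_derivative)
  let ?f = "\<lambda>t. norm (x + w *\<^sub>C y + t *\<^sub>R h)" and ?f' = "\<lambda>t. norm (x + (- w) *\<^sub>C y + t *\<^sub>R h)"
  show "((\<lambda>t. (?f t + ?f' t) / 2) has_real_derivative (d + d') / 2) (at 0)"
    by (intro DERIV_cdivide DERIV_add d d')
  show "norm (x + y + 0 *\<^sub>R (e \<cdot> h)) = (?f 0 + ?f' 0) / 2"
    using norm_rotation[OF e w x y] norm_rotation[OF e _ x y, of "- w"] w by simp
  fix t :: real
  have "norm (2 *\<^sub>R (x + y)) \<le> norm (x + y + t *\<^sub>R (e \<cdot> h)) + norm (x + y + (- t) *\<^sub>R (e \<cdot> h))"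
    using norm_triangle_ineq[of "x + y + t *\<^sub>R (e \<cdot> h)" "x + y + (- t) *\<^sub>R (e \<cdot> h)"]
    by (simp add: scaleR_2 algebra_simps)
  then show "2 * norm (x + y + 0 *\<^sub>R (e \<cdot> h))
      \<le> norm (x + y + t *\<^sub>R (e \<cdot> h)) + norm (x + y + (- t) *\<^sub>R (e \<cdot> h))"
    by simp
  have rot: "norm (x + y + t *\<^sub>R ((e + cnj v *\<^sub>C (1 - e)) \<cdot> h)) \<le> norm (x + v *\<^sub>C y + t *\<^sub>R h)"
    if v: "cmod v = 1" for v
    using norm_act_le[of "e + cnj v *\<^sub>C (1 - e)" "x + v *\<^sub>C y + t *\<^sub>R h"]
      hermitian_idempotent_rotation[OF e, of "cnj v"] v
    by (simp add: blinfun.add_right[of _ "x + v *\<^sub>C y"] blinfun.scaleR_right rotation_act[OF e v x y])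
  let ?r = "\<lambda>v. x + y + t *\<^sub>R ((e + cnj v *\<^sub>C (1 - e)) \<cdot> h)"
  \<comment> \<open>Averaging the rotations for \<open>w\<close> and \<open>- w\<close> cancels the
    \<open>1 - e\<close> part and leaves \<open>e\<close>.\<close>
  have "2 *\<^sub>R (x + y + t *\<^sub>R (e \<cdot> h)) = ?r w + ?r (- w)"
    unfolding scaleR_2
    by (simp add: act_add act_diff act_scaleC scaleC_minus_left algebra_simps)
  then have "norm (2 *\<^sub>R (x + y + t *\<^sub>R (e \<cdot> h))) \<le> norm (?r w) + norm (?r (- w))"
    by (simp only: norm_triangle_ineq)
  also have "\<dots> \<le> ?f t + ?f' t"
    using w by (intro add_mono rot) auto
  finally show "norm (x + y + t *\<^sub>R (e \<cdot> h)) \<le> (?f t + ?f' t) / 2"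
    by simp
qed

end

section \<open>Disjoint supports and commutation for \<open>p \<noteq> 2\<close>\<close>

locale Lp_rep = Lp_space p M q + isometric_rep \<phi>
  for p and M :: "'b measure" and q :: "('b \<Rightarrow> complex) \<Rightarrow> 'e::complex_banach"
    and \<phi> :: "'a::complex_banach_algebra_1 \<Rightarrow> ('e \<Rightarrow>\<^sub>L 'e)"
begin

text \<open>\<open>F w\<close> is the duality map at \<open>x + w y\<close>. The mean of the norm
  derivatives at \<open>x \<plusminus> w y\<close> is the derivative at \<open>x + y\<close> along
  \<open>e \<cdot> q h\<close>, the same for all unimodular \<open>w\<close>. Comparing
  \<open>w = 1\<close> with \<open>w = \<i>\<close> makes an integral vanish, and \<open>h\<close>
  is chosen so that its integrand is nonnegative.\<close>

lemma duality_difference_eq_0: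
  assumes e: "hermitian_idempotent e"
    and x: "x \<in> Lp_functions p M" "e \<cdot> q x = q x"
    and y: "y \<in> Lp_functions p M" "(1 - e) \<cdot> q y = q y"
  defines "F \<equiv> \<lambda>w a. cmod (x a + w * y a) powr (p - 2) *\<^sub>R (x a + w * y a)"
  shows "AE a in M. cmod (x a) \<noteq> cmod (y a) \<longrightarrow> F 1 a + F (- 1) a = F \<i> a + F (- \<i>) a"
proof (cases "q x + q y = 0")
  \<comment> \<open>The norm is not differentiable at \<open>0\<close>; but in this case
    \<open>x\<close> and \<open>y\<close> both vanish almost everywhere.\<close>
  case True
  have "q x + (- 1) *\<^sub>C q y = 0"
    using norm_rotation[OF e _ x(2) y(2), of "- 1"] True by simp
  then have eq: "q x = q y"
    by (simp add: scaleC_minus_left scaleC_one)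
  then have "2 *\<^sub>R q y = 0" using True by (simp add: scaleR_2)
  with eq have "q x = 0" "q y = 0" by simp_all
  then have "AE a in M. x a = 0" "AE a in M. y a = 0"
    using q_eq_0_iff x(1) y(1) by auto
  then show ?thesis by eventually_elim simp
next
  case False
  have [measurable]: "x \<in> borel_measurable M" "y \<in> borel_measurable M"
    using x y by (auto simp: Lp_functions_def)
  define S where "S a = F 1 a + F (- 1) a - F \<i> a - F (- \<i>) a" for a
  \<comment> \<open>The phase of \<open>g\<close> makes \<open>x * g * cnj S\<close> nonnegative,
    and the denominator keeps its modulus at most \<open>1\<close>, so that \<open>x * g\<close> is
    \<open>p\<close>-integrable. Cutting \<open>h\<close> off where the moduli of \<open>x\<close>
    and \<open>y\<close> agree avoids all zeros of \<open>x + w y\<close>.\<close>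
  define g where "g a = cnj (x a * cnj (S a)) / of_real (1 + cmod (x a * S a))" for a
  define h where "h a = (if cmod (x a) = cmod (y a) then 0 else x a * g a)" for a
  define u where "u w a = x a + w * y a" for w a
  have [measurable]: "S \<in> borel_measurable M" "g \<in> borel_measurable M" "h \<in> borel_measurable M"
    unfolding S_def F_def g_def h_def by measurable
  have "cmod (g a) \<le> 1" for a
  proof -
    have "cmod (g a) = cmod (x a * S a) / \<bar>1 + cmod (x a * S a)\<bar>"
      unfolding g_def norm_divide norm_of_real by (simp only: norm_mult complex_mod_cnj)
    moreover have "c / \<bar>1 + c\<bar> \<le> 1" if "0 \<le> c" for c :: real
      using that by (simp add: divide_le_eq)
    ultimately show ?thesis by (metis norm_ge_zero)
  qed
  then have "cmod (h a) \<le> cmod (x a) + 0 * cmod (x a)" for a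
    unfolding h_def by (simp add: norm_mult mult_left_le)
  then have h: "h \<in> Lp_functions p M"
    by (intro Lp_functions_dominated(1)[where C = 0, OF x(1) x(1) p]) auto
  have u: "u w \<in> Lp_functions p M" "q (u w) = q x + w *\<^sub>C q y" for w
    unfolding u_def using q_lincomb[OF x(1) y(1)] by auto
  have supp: "u w a \<noteq> 0 \<or> h a = 0" if "cmod w = 1" for w a
  proof (cases "u w a = 0")
    case True
    then have "cmod (x a) = cmod (w * y a)" by (simp add: u_def eq_neg_iff_add_eq_0[symmetric])
    then show ?thesis using that by (simp add: h_def norm_mult)
  qed simp
  let ?J = "\<lambda>w. \<integral>a. cmod (u w a) powr (p - 2) * Re (h a * cnj (u w a)) \<partial>M"
  define N where "N = norm (q x + q y)"
  have N: "norm (q (u w)) = N" if "cmod w = 1" for w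
    using norm_rotation[OF e that x(2) y(2)] by (simp add: u N_def)
  have "N > 0" using False by (simp add: N_def)
  have der: "((\<lambda>t. norm (q x + w *\<^sub>C q y + t *\<^sub>R q h)) has_real_derivative N powr (1 - p) * ?J w) (at 0)"
    if w: "cmod w = 1" for w
    using DERIV_norm_q[OF u(1) h supp[OF w]] N[OF w] \<open>N > 0\<close> by (auto simp: u(2))
  have "((\<lambda>t. norm (q x + q y + t *\<^sub>R (e \<cdot> q h))) has_real_derivative
      (N powr (1 - p) * ?J w + N powr (1 - p) * ?J (- w)) / 2) (at 0)" if w: "cmod w = 1" for w
    using w by (intro DERIV_norm_mean[OF e w x(2) y(2)] der) auto
  from DERIV_unique[OF this[of 1] this[of \<i>]]
  have "N powr (1 - p) * (?J 1 + ?J (- 1)) = N powr (1 - p) * (?J \<i> + ?J (- \<i>))"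
    by (simp add: distrib_left)
  then have J: "?J 1 + ?J (- 1) = ?J \<i> + ?J (- \<i>)"
    using \<open>N > 0\<close> by simp
  have int: "integrable M (\<lambda>a. cmod (u w a) powr (p - 2) * Re (h a * cnj (u w a)))"
    if "cmod w = 1" for w
    using integrable_mult_right[OF DERIV_integral_powr(1)[OF u(1) h p supp[OF that]], of "1 / p"] p
    by (simp add: mult.assoc)
  let ?G = "\<lambda>a. Re (h a * cnj (S a))"
  have G_eq: "?G a = cmod (u 1 a) powr (p - 2) * Re (h a * cnj (u 1 a))
      + cmod (u (- 1) a) powr (p - 2) * Re (h a * cnj (u (- 1) a))
      - cmod (u \<i> a) powr (p - 2) * Re (h a * cnj (u \<i> a))
      - cmod (u (- \<i>) a) powr (p - 2) * Re (h a * cnj (u (- \<i>) a))" for a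
    unfolding S_def F_def u_def by (simp add: algebra_simps)
  have "integrable M ?G" "(\<integral>a. ?G a \<partial>M) = 0"
    unfolding G_eq using int J by simp_all
  moreover have G: "?G a = (if cmod (x a) = cmod (y a) then 0
      else (cmod (x a * S a))\<^sup>2 / (1 + cmod (x a * S a)))" for a
  proof -
    have "x a * g a * cnj (S a) = of_real ((cmod (x a * S a))\<^sup>2 / (1 + cmod (x a * S a)))"
    proof -
      have "x a * g a * cnj (S a) = (x a * cnj (S a)) * cnj (x a * cnj (S a)) / of_real (1 + cmod (x a * S a))"
        by (simp add: g_def)
      also have "(x a * cnj (S a)) * cnj (x a * cnj (S a)) = of_real ((cmod (x a * S a))\<^sup>2)"
        unfolding complex_norm_square[symmetric] by (simp add: norm_mult)
      finally show ?thesis by simp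
    qed
    then have "Re (x a * g a * cnj (S a)) = (cmod (x a * S a))\<^sup>2 / (1 + cmod (x a * S a))"
      by (simp only: Re_complex_of_real)
    then show ?thesis
      unfolding h_def by (cases "cmod (x a) = cmod (y a)") (simp_all del: times_complex.sel)
  qed
  ultimately have "AE a in M. ?G a = 0"
    using integral_nonneg_eq_0_iff_AE[of M ?G] by simp
  then show ?thesis
  proof eventually_elim
    case (elim a)
    show ?case
    proof
      assume ne: "cmod (x a) \<noteq> cmod (y a)"
      then have "(cmod (x a * S a))\<^sup>2 / (1 + cmod (x a * S a)) = 0"
        using elim G[of a] by simp
      moreover have "1 + cmod (x a * S a) > 0" by (simp add: add_pos_nonneg)
      ultimately have "x a = 0 \<or> S a = 0"
        by auto
      then show "F 1 a + F (- 1) a = F \<i> a + F (- \<i>) a"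
      proof
        \<comment> \<open>For \<open>x a = 0\<close> the map \<open>F\<close> is odd in
          \<open>w\<close>, so both sides are zero.\<close>
        assume "x a = 0"
        then show ?thesis by (simp add: F_def norm_mult)
      qed (simp add: S_def diff_diff_eq)
    qed
  qed
qed

lemma disjoint_support:
  assumes "p \<noteq> 2" and e: "hermitian_idempotent e"
    and x: "x \<in> Lp_functions p M" "e \<cdot> q x = q x"
    and y: "y \<in> Lp_functions p M" "(1 - e) \<cdot> q y = q y"
  shows "AE a in M. x a = 0 \<or> y a = 0"
proof -
  have *: "AE a in M. cmod (x a) = cmod (z a) \<or> x a = 0 \<or> z a = 0"
    if z: "z \<in> Lp_functions p M" "(1 - e) \<cdot> q z = q z" for z
  proof -
    have e': "(1 - (1 - e)) \<cdot> q x = q x" using x by simp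
    show ?thesis
      using duality_difference_eq_0[OF e x z]
        duality_difference_eq_0[OF hermitian_idempotent_compl[OF e] z x(1) e']
    proof eventually_elim
      case (elim a)
      \<comment> \<open>Exchanging \<open>x\<close> and \<open>z\<close> replaces \<open>w\<close>
        by its conjugate in the weights, so both equations involve the same four moduli.\<close>
      have mods: "cmod (z a + x a) = cmod (x a + z a)" "cmod (z a - x a) = cmod (x a - z a)"
        "cmod (z a + \<i> * x a) = cmod (x a - \<i> * z a)" "cmod (z a - \<i> * x a) = cmod (x a + \<i> * z a)"
        unfolding cmod_def by (simp_all add: power2_eq_square algebra_simps)
      show ?case
      proof (rule disjCI)
        assume "\<not> (x a = 0 \<or> z a = 0)"
        then show "cmod (x a) = cmod (z a)"
          using differenced_duality_cancel[of "p - 2" "x a" "z a"] elim \<open>p \<noteq> 2\<close> mods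
          by (auto simp: scaleR_conv_of_real)
      qed
    qed
  qed
  \<comment> \<open>Where neither function vanishes, \<open>cmod (x a)\<close> would equal both
    \<open>cmod (y a)\<close> and its double.\<close>
  have y2: "(\<lambda>a. 2 * y a) \<in> Lp_functions p M" "(1 - e) \<cdot> q (\<lambda>a. 2 * y a) = q (\<lambda>a. 2 * y a)"
    using y Lp_functions_cmult[OF y(1) p] by (simp_all add: q_cmult act_scaleC_right)
  show ?thesis
    using *[OF y] *[OF y2] by eventually_elim (auto simp: norm_mult)
qed

lemma hermitian_idempotents_commute:
  fixes e f :: 'a
  assumes "p \<noteq> 2" and e: "hermitian_idempotent e" and f: "hermitian_idempotent f"
  shows "e * f = f * e"
proof -
  \<comment> \<open>For \<open>y\<close> in the range of \<open>1 - e\<close>, disjointness makes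
    \<open>a\<close> a restriction of \<open>y\<close>, and \<open>c\<close> a restriction of
    \<open>a\<close>. But \<open>c\<close>, in the range of \<open>e\<close>, is also disjoint from
    \<open>y\<close>.\<close>
  have absorb: "e * f * (1 - e) = 0" if e: "hermitian_idempotent e" for e :: 'a
  proof (rule act_eq_0)
    fix v
    note idem = hermitian_idempotent_idem[OF e] hermitian_idempotent_idem[OF f]
      hermitian_idempotent_idem[OF hermitian_idempotent_compl[OF e]]
      hermitian_idempotent_idem[OF hermitian_idempotent_compl[OF f]]
    obtain y where y: "y \<in> Lp_functions p M" "q y = (1 - e) \<cdot> v" by (rule q_surj)
    obtain a where a: "a \<in> Lp_functions p M" "q a = f \<cdot> q y" by (rule q_surj)
    obtain b where b: "b \<in> Lp_functions p M" "q b = (1 - f) \<cdot> q y" by (rule q_surj)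
    obtain c where c: "c \<in> Lp_functions p M" "q c = e \<cdot> q a" by (rule q_surj)
    obtain d where d: "d \<in> Lp_functions p M" "q d = (1 - e) \<cdot> q a" by (rule q_surj)
    have sums: "q y = q a + 1 *\<^sub>C q b" "q a = q c + 1 *\<^sub>C q d"
    proof -
      have "(1 - e) * f * (1 - e) + e * f * (1 - e) = f * (1 - e)" by (simp add: algebra_simps)
      \<comment> \<open>The unit acts as the identity on vectors already of the form
        \<open>z \<cdot> v\<close>.\<close>
      moreover have "1 \<cdot> (1 - e) \<cdot> v = (1 - e) \<cdot> v" "1 \<cdot> f \<cdot> (1 - e) \<cdot> v = f \<cdot> (1 - e) \<cdot> v"
        by (simp_all flip: act_mult)
      ultimately show "q y = q a + 1 *\<^sub>C q b" "q a = q c + 1 *\<^sub>C q d"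
        by (simp_all add: a b c d y scaleC_one act_diff)
    qed
    have "AE s in M. y s = a s + 1 * b s" "AE s in M. a s = c s + 1 * d s"
      using sums q_eq_iff q_lincomb a(1) b(1) c(1) d(1) y(1) by metis+
    moreover have "AE s in M. a s = 0 \<or> b s = 0"
      by (rule disjoint_support[OF \<open>p \<noteq> 2\<close> f a(1) _ b(1)]) (simp_all add: a b idem flip: act_mult)
    moreover have "AE s in M. c s = 0 \<or> d s = 0"
      by (rule disjoint_support[OF \<open>p \<noteq> 2\<close> e c(1) _ d(1)]) (simp_all add: c d idem flip: act_mult)
    moreover have "AE s in M. c s = 0 \<or> y s = 0"
      by (rule disjoint_support[OF \<open>p \<noteq> 2\<close> e c(1) _ y(1)]) (simp_all add: c y idem flip: act_mult)
    ultimately have "AE s in M. c s = 0"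
      by eventually_elim auto
    then have "q c = 0" using q_eq_0_iff c(1) by simp
    then show "(e * f * (1 - e)) \<cdot> v = 0"
      by (simp add: act_mult c a y)
  qed
  \<comment> \<open>Both off-diagonal corners of \<open>f\<close> with respect to \<open>e\<close>
    vanish.\<close>
  have "e * f = e * f * e" "f * e = e * f * e"
    using absorb[OF e] absorb[OF hermitian_idempotent_compl[OF e]]
    by (simp_all add: left_diff_distrib right_diff_distrib)
  then show ?thesis by simp
qed

end

section \<open>The Hilbert space case \<open>p = 2\<close>\<close>

context Lp_rep
begin

text \<open>Real part of the inner product, recovered from the norm by polarization because
  \<open>'e\<close> is only given as a Banach space.\<close>

definition re_inner :: "'e \<Rightarrow> 'e \<Rightarrow> real" where
  "re_inner v w = ((norm (v + w))\<^sup>2 - (norm v)\<^sup>2 - (norm w)\<^sup>2) / 2"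

lemma re_inner_q:
  assumes "p = 2" and f: "f \<in> Lp_functions p M" and g: "g \<in> Lp_functions p M"
  shows "integrable M (\<lambda>x. Re (f x * cnj (g x)))" (is ?int)
    and "re_inner (q f) (q g) = (\<integral>x. Re (f x * cnj (g x)) \<partial>M)" (is ?eq)
proof -
  have sq: "(norm (q k))\<^sup>2 = (\<integral>x. (cmod (k x))\<^sup>2 \<partial>M)" "integrable M (\<lambda>x. (cmod (k x))\<^sup>2)"
    if "k \<in> Lp_functions p M" for k
    using norm_q_powr[OF that] that \<open>p = 2\<close> by (simp_all add: Lp_functions_def)
  have fg: "(\<lambda>x. f x + g x) \<in> Lp_functions p M" "q (\<lambda>x. f x + g x) = q f + q g"
    using f g by (simp_all add: Lp_functions_add p q_add)
  have polar: "Re (f x * cnj (g x)) = ((cmod (f x + g x))\<^sup>2 - (cmod (f x))\<^sup>2 - (cmod (g x))\<^sup>2) / 2" for x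
    unfolding cmod_power2 by (simp add: power2_eq_square algebra_simps)
  show ?int unfolding polar
    using sq(2)[OF fg(1)] sq(2)[OF f] sq(2)[OF g] by simp
  show ?eq unfolding polar re_inner_def fg(2)[symmetric] sq(1)[OF fg(1)] sq(1)[OF f] sq(1)[OF g]
    using sq(2)[OF fg(1)] sq(2)[OF f] sq(2)[OF g] by simp
qed

lemma re_inner_commute: "re_inner v w = re_inner w v"
  by (simp add: re_inner_def add.commute)

lemma re_inner_self: "re_inner v v = (norm v)\<^sup>2"
proof -
  have "norm (v + v) = 2 * norm v" by (simp flip: scaleR_2)
  then show ?thesis by (simp add: re_inner_def power2_eq_square)
qed

lemma re_inner_le: "re_inner v w \<le> norm v * norm w"
proof -
  have "(norm (v + w))\<^sup>2 \<le> (norm v + norm w)\<^sup>2"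
    by (intro power_mono norm_triangle_ineq norm_ge_zero)
  then show ?thesis by (simp add: re_inner_def power2_eq_square algebra_simps)
qed

text \<open>Linearity is not visible in the polarized norm; it is inherited from the integral
  formula for \<open>p = 2\<close>.\<close>

lemma re_inner_lincomb_right:
  assumes "p = 2"
  shows "re_inner u (v + t *\<^sub>R w) = re_inner u v + t * re_inner u w"
proof -
  obtain f where f: "f \<in> Lp_functions p M" "q f = u" by (rule q_surj)
  obtain g where g: "g \<in> Lp_functions p M" "q g = v" by (rule q_surj)
  obtain h where h: "h \<in> Lp_functions p M" "q h = w" by (rule q_surj)
  note gh = q_lincomb[OF g(1) h(1), of "of_real t"]
  have "re_inner u (v + t *\<^sub>R w) = (\<integral>x. Re (f x * cnj (g x + of_real t * h x)) \<partial>M)"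
    using re_inner_q(2)[OF assms f(1) gh(1)] by (simp add: gh(2) f g h scaleR_scaleC)
  also have "\<dots> = (\<integral>x. Re (f x * cnj (g x)) + t * Re (f x * cnj (h x)) \<partial>M)"
    by (simp add: algebra_simps)
  also have "\<dots> = re_inner u v + t * re_inner u w"
    using re_inner_q[OF assms f(1) g(1)] re_inner_q[OF assms f(1) h(1)] by (simp add: f g h)
  finally show ?thesis .
qed

text \<open>As \<open>e\<close> is contractive and maps \<open>x + t y\<close> to \<open>x\<close>,
  the norm of \<open>x + t y\<close> is least at \<open>t = 0\<close>; the linear term of its square
  must vanish.\<close>

lemma re_inner_orthogonal:
  assumes "p = 2" and e: "hermitian_idempotent e" and x: "e \<cdot> x = x" and y: "e \<cdot> y = 0"
  shows "re_inner x y = 0"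
proof -
  define b c where "b = re_inner x y" and "c = (norm y)\<^sup>2"
  have "c \<ge> 0" by (simp add: c_def)
  have "0 \<le> 2 * t * b + t\<^sup>2 * c" for t
  proof -
    have "e \<cdot> (x + t *\<^sub>R y) = x"
      by (simp add: blinfun.add_right blinfun.scaleR_right x y)
    then have "norm x \<le> norm e * norm (x + t *\<^sub>R y)"
      using norm_act_le[of e "x + t *\<^sub>R y"] by simp
    also have "\<dots> \<le> norm (x + t *\<^sub>R y)"
      using norm_hermitian_idempotent_le[OF e] by (simp add: mult_left_le_one_le)
    finally have "(norm x)\<^sup>2 \<le> re_inner (x + t *\<^sub>R y) (x + t *\<^sub>R y)"
      unfolding re_inner_self by (simp add: power_mono)
    also have "\<dots> = (norm x)\<^sup>2 + 2 * t * b + t\<^sup>2 * c"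
      unfolding re_inner_lincomb_right[OF \<open>p = 2\<close>] re_inner_commute[of "x + t *\<^sub>R y"]
      by (simp add: b_def c_def re_inner_commute[of y x] re_inner_self power2_eq_square algebra_simps)
    finally show ?thesis by simp
  qed
  \<comment> \<open>Near the minimiser \<open>- b / c\<close>, with \<open>c + 1\<close> to avoid
    dividing by zero.\<close>
  from this[of "- b / (c + 1)"] have "0 \<le> - 2 * b\<^sup>2 / (c + 1) + b\<^sup>2 * c / (c + 1)\<^sup>2"
    by (simp add: power_divide power2_eq_square)
  also have "\<dots> = - (b\<^sup>2 * (c + 2)) / (c + 1)\<^sup>2"
    using \<open>c \<ge> 0\<close> by (simp add: divide_simps power2_eq_square) (simp add: algebra_simps)
  finally have "b\<^sup>2 * (c + 2) \<le> 0"
    using \<open>c \<ge> 0\<close> by (simp add: divide_le_0_iff zero_le_divide_iff)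
  then have "b = 0" using \<open>c \<ge> 0\<close> by (simp add: mult_le_0_iff)
  then show ?thesis by (simp add: b_def)
qed

text \<open>Since \<open>w - e \<cdot> w\<close> lies in the kernel of \<open>e\<close>, both sides
  equal the product of \<open>e \<cdot> v\<close> and \<open>e \<cdot> w\<close>.\<close>

lemma re_inner_selfadjoint:
  assumes "p = 2" and e: "hermitian_idempotent e"
  shows "re_inner (e \<cdot> v) w = re_inner v (e \<cdot> w)"
proof -
  have half: "re_inner (e \<cdot> v) w = re_inner (e \<cdot> v) (e \<cdot> w)" for v w
  proof -
    have idem: "e \<cdot> e \<cdot> u = e \<cdot> u" for u
      using hermitian_idempotent_idem[OF e] by (simp flip: act_mult)
    have "re_inner (e \<cdot> v) (w + (- 1) *\<^sub>R (e \<cdot> w)) = 0"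
      by (rule re_inner_orthogonal[OF assms]) (simp_all add: idem blinfun.add_right blinfun.minus_right blinfun.diff_right)
    then show ?thesis unfolding re_inner_lincomb_right[OF \<open>p = 2\<close>] by simp
  qed
  show ?thesis using half[of v w] half[of w v] by (metis re_inner_commute)
qed

text \<open>The two products are adjoint to each other, and Cauchy-Schwarz bounds the norm of an
  operator by that of its adjoint.\<close>

lemma hermitian_idempotent_swap:
  fixes e f :: 'a
  assumes "p = 2" and e: "hermitian_idempotent e" and f: "hermitian_idempotent f"
  shows "norm (e * (1 - f)) \<le> norm ((1 - f) * e)"
  unfolding norm_rep[of "e * (1 - f)", symmetric]
proof (rule norm_blinfun_bound)
  fix v
  define w where "w = (e * (1 - f)) \<cdot> v"
  have "norm w * norm w = re_inner (e \<cdot> (1 - f) \<cdot> v) w"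
    using re_inner_self[of w] by (simp add: w_def act_mult power2_eq_square)
  also have "\<dots> = re_inner v (((1 - f) * e) \<cdot> w)"
    by (simp add: re_inner_selfadjoint[OF \<open>p = 2\<close>] e hermitian_idempotent_compl[OF f] act_mult)
  also have "\<dots> \<le> norm v * (norm ((1 - f) * e) * norm w)"
    by (rule order_trans[OF re_inner_le mult_left_mono[OF norm_act_le norm_ge_zero]])
  finally have "norm w * norm w \<le> (norm ((1 - f) * e) * norm v) * norm w"
    by (simp add: ac_simps)
  then show "norm ((e * (1 - f)) \<cdot> v) \<le> norm ((1 - f) * e) * norm v"
    unfolding w_def[symmetric] using mult_right_le_imp_le[of "norm w" "norm w"]
    by (cases "w = 0") auto
qed simp

lemma rakocevic_conjecture: "rakocevic_conjecture TYPE('a)"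
proof (cases "p = 2")
  case True
  then show ?thesis by (rule rakocevic_if_swap[OF hermitian_idempotent_swap])
next
  case False
  then show ?thesis by (rule rakocevic_if_commute[OF hermitian_idempotents_commute])
qed

end

theorem theoremC:
  shows "((\<forall>e::'a::complex_banach_algebra_1. idempotent e \<and> hermitian e \<longrightarrow> ultrahermitian e) \<and>
          (\<forall>e f::'a. idempotent e \<and> hermitian e \<and> idempotent f \<and> hermitian f \<longrightarrow> e * f = f * e)
            \<longrightarrow> rakocevic_conjecture TYPE('a)) \<and>
         (\<forall>p::real. 1 \<le> p \<longrightarrow>
            Lp_operator_algebra p TYPE('b) TYPE('e::complex_banach) TYPE('a) \<longrightarrow>
            rakocevic_conjecture TYPE('a))"
proof (intro conjI allI impI; (elim conjE)?)
  assume "\<forall>e f::'a. idempotent e \<and> hermitian e \<and> idempotent f \<and> hermitian f \<longrightarrow> e * f = f * e"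
  then show "rakocevic_conjecture TYPE('a)"
    by (intro rakocevic_if_commute) (simp add: hermitian_idempotent_def)
next
  fix p :: real
  assume p: "1 \<le> p" "Lp_operator_algebra p TYPE('b) TYPE('e) TYPE('a)"
  then obtain M :: "'b measure" and q :: "('b \<Rightarrow> complex) \<Rightarrow> 'e" and \<phi> :: "'a \<Rightarrow> ('e \<Rightarrow>\<^sub>L 'e)"
    where "Lp_quotient_map p M q" "isometric_representation \<phi>"
    unfolding Lp_operator_algebra_def by blast
  with p interpret Lp_rep p M q \<phi>
    by unfold_locales
  show "rakocevic_conjecture TYPE('a)"
    by (rule rakocevic_conjecture)
qed

end
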